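(* Let $R$ be a commutative ring with identity and let $S$ be an anti-Archimedean multiplicative subset of $R$. Let $M$ be an $R$-module. Then $M$ is uniformly $S$-Noetherian if and only if there exists $s\in S$ such that $M$ is $s$-finite and, for every prime ideal $\mathfrak p$ of $R$ with $\operatorname{Ann}_R(M)\subseteq \mathfrak p$, there exists an $s$-finite submodule $N^{\mathfrak p}$ of $M$ satisfying $\mathfrak p M\subseteq N^{\mathfrak p}\subseteq M(\mathfrak p)$, where $M(\mathfrak p)=\{x\in M \mid rx\in \mathfrak p M \text{ for some } r\in R\setminus \mathfrak p\}$.
   Context: All rings are commutative with identity and all modules are unitary. A multiplicative subset $S$ of $R$ is a subset with $1\in S$ and $s_1s_2\in S$ for all $s_1,s_2\in S$. It is called anti-Archimedean if $\left(\bigcap_{n\geq 1}s^nR\right)\cap S\neq\emptyset$ for every $s\in S$. $\operatorname{Ann}_R(M)=\{r\in R\mid rM=0\}$. For $s\in S$, an $R$-module $N$ is $s$-finite if there is a finitely generated $R$-submodule $F$ of $N$ with $sN\subseteq F\subseteq N$. An $R$-module $M$ is uniformly $S$-Noetherian if there exists a single element $s\in S$ such that every submodule of $M$ is $s$-finite. *)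

theory Defs
  imports "HOL-Algebra.Module" "HOL-Algebra.Ideal" "HOL.Hull"
begin

definition anti_archimedean :: "('a, 'm) ring_scheme \<Rightarrow> 'a set \<Rightarrow> bool"
  where "anti_archimedean R S \<longleftrightarrow>
    (\<forall>s\<in>S. (\<Inter>n\<in>{1::nat..}. PIdl\<^bsub>R\<^esub> (s [^]\<^bsub>R\<^esub> n)) \<inter> S \<noteq> {})"

definition annihilator :: "('a, 'm) ring_scheme \<Rightarrow> ('a, 'b, 'n) module_scheme \<Rightarrow> 'a set"
  where "annihilator R M = {r \<in> carrier R. \<forall>x\<in>carrier M. r \<odot>\<^bsub>M\<^esub> x = \<zero>\<^bsub>M\<^esub>}"

definition submodule_span ::
    "('a, 'm) ring_scheme \<Rightarrow> ('a, 'b, 'n) module_scheme \<Rightarrow> 'b set \<Rightarrow> 'b set"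
  where "submodule_span R M A = (\<lambda>N. submodule N R M) hull A"

definition fg_submodule ::
    "('a, 'm) ring_scheme \<Rightarrow> ('a, 'b, 'n) module_scheme \<Rightarrow> 'b set \<Rightarrow> bool"
  where "fg_submodule R M F \<longleftrightarrow>
    (\<exists>A. finite A \<and> A \<subseteq> carrier M \<and> F = submodule_span R M A)"

text \<open>
  In \<open>s_finite R M s N\<close> the set \<open>N\<close> is meant to be a submodule of \<open>M\<close>; its submodules are
  then exactly the submodules of \<open>M\<close> contained in \<open>N\<close>. The module \<open>M\<close> itself is \<open>s\<close>-finite
  when \<open>s_finite R M s (carrier M)\<close> holds.
\<close>
definition s_finite ::
    "('a, 'm) ring_scheme \<Rightarrow> ('a, 'b, 'n) module_scheme \<Rightarrow> 'a \<Rightarrow> 'b set \<Rightarrow> bool"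
  where "s_finite R M s N \<longleftrightarrow>
    (\<exists>F. fg_submodule R M F \<and> (\<lambda>x. s \<odot>\<^bsub>M\<^esub> x) ` N \<subseteq> F \<and> F \<subseteq> N)"

definition uniformly_S_Noetherian ::
    "('a, 'm) ring_scheme \<Rightarrow> 'a set \<Rightarrow> ('a, 'b, 'n) module_scheme \<Rightarrow> bool"
  where "uniformly_S_Noetherian R S M \<longleftrightarrow>
    (\<exists>s\<in>S. \<forall>N. submodule N R M \<longrightarrow> s_finite R M s N)"

text \<open>The submodule \<open>IM\<close> is generated by the products, not merely the set of products.\<close>
definition ideal_smult ::
    "('a, 'm) ring_scheme \<Rightarrow> ('a, 'b, 'n) module_scheme \<Rightarrow> 'a set \<Rightarrow> 'b set"
  where "ideal_smult R M I = submodule_span R M {a \<odot>\<^bsub>M\<^esub> x | a x. a \<in> I \<and> x \<in> carrier M}"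

definition prime_saturation ::
    "('a, 'm) ring_scheme \<Rightarrow> ('a, 'b, 'n) module_scheme \<Rightarrow> 'a set \<Rightarrow> 'b set"
  where "prime_saturation R M P =
    {x \<in> carrier M. \<exists>r \<in> carrier R - P. r \<odot>\<^bsub>M\<^esub> x \<in> ideal_smult R M P}"

end

theory Submission
  imports Defs
begin

text \<open>
  The forward direction takes the submodule \<open>\<pp>M\<close> itself for \<open>N\<^sup>\<pp>\<close>. The converse is a Cohen-type
  argument. The finiteness conditions at the single element \<open>s\<close> do not compose, since each
  combination of two of them multiplies the witnesses. So \<open>s\<close> is replaced by the multiplicative
  set \<open>T\<close> of its powers, and a submodule is called \<open>T\<close>-finite if it is \<open>t\<close>-finite for some
  \<open>t \<in> T\<close>. The anti-Archimedean property serves at the very end: an element of \<open>S\<close> that is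
  divisible by every power of \<open>s\<close> is a uniform witness for all \<open>T\<close>-finite submodules.

  It remains to prove that every submodule is \<open>T\<close>-finite, for an arbitrary multiplicative set \<open>T\<close>.
  If not, Zorn's lemma gives a submodule \<open>N\<close> that is maximal among those that are not \<open>T\<close>-finite
  (\<open>maximal_non_S_finite_exists\<close>). Everything then follows from one extension principle
  (\<open>s_finite_extension\<close>): if \<open>N + H\<close> is \<open>T\<close>-finite and \<open>N \<inter> H\<close> lies in a \<open>T\<close>-finite submodule
  of \<open>N\<close>, then \<open>N\<close> is \<open>T\<close>-finite. It is used twice.

  With \<open>H = aM\<close>, where \<open>N \<inter> aM = a(N : a)\<close>, it shows that \<open>N\<close> is a prime submodule: \<open>ax \<in> N\<close>
  forces \<open>x \<in> N\<close> or \<open>aM \<subseteq> N\<close> (\<open>maximal_non_S_finite_prime\<close>). Hence \<open>\<pp> = (N : M)\<close> is a prime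
  ideal and \<open>M(\<pp>) \<subseteq> N\<close>, so that the submodule \<open>N\<^sup>\<pp>\<close> given by the hypothesis satisfies
  \<open>\<pp>M \<subseteq> N\<^sup>\<pp> \<subseteq> N\<close>. With \<open>H = Rx\<close> for any \<open>x \<notin> N\<close>, which
  exists because \<open>M\<close> is \<open>T\<close>-finite and \<open>N\<close> is not, primeness of \<open>N\<close> gives
  \<open>N \<inter> Rx = \<pp>x \<subseteq> N\<^sup>\<pp>\<close>, and the principle makes \<open>N\<close> itself \<open>T\<close>-finite, a contradiction.
\<close>

text \<open>
  The witness may depend on the submodule; a fixed witness would not survive the extension principle.
\<close>
definition S_finite ::
    "('a, 'm) ring_scheme \<Rightarrow> ('a, 'b, 'n) module_scheme \<Rightarrow> 'a set \<Rightarrow> 'b set \<Rightarrow> bool"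
  where "S_finite R M T N \<longleftrightarrow> (\<exists>t\<in>T. s_finite R M t N)"

context module
begin

section \<open>Submodules, sums, colons and spans\<close>

lemma submodule_zero: "submodule N R M \<Longrightarrow> \<zero>\<^bsub>M\<^esub> \<in> N"
  using subgroup.one_closed[OF submodule.axioms(1)] by fastforce

lemma submodule_minus:
  assumes "submodule N R M" "x \<in> N" "y \<in> N"
  shows "x \<ominus>\<^bsub>M\<^esub> y \<in> N"
  using submoduleE[OF assms(1)] assms(2,3) by (simp add: a_minus_def)

lemma submodule_Inter:
  assumes "\<C> \<noteq> {}" "\<And>N. N \<in> \<C> \<Longrightarrow> submodule N R M"
  shows "submodule (\<Inter>\<C>) R M"
  using assms by (intro submoduleI) (auto dest: submoduleE submodule_zero)

lemma submodule_chain_Union: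
  assumes "\<C> \<noteq> {}" "subset.chain {N. submodule N R M} \<C>"
  shows "submodule (\<Union>\<C>) R M"
proof -
  have sub: "submodule N R M" if "N \<in> \<C>" for N
    using assms(2) that by (auto simp: subset.chain_def)
  have tot: "N \<subseteq> L \<or> L \<subseteq> N" if "N \<in> \<C>" "L \<in> \<C>" for N L
    using assms(2) that unfolding subset_chain_def by blast
  show ?thesis
  proof (rule submoduleI)
    fix x y assume "x \<in> \<Union>\<C>" "y \<in> \<Union>\<C>"
    then obtain N where "N \<in> \<C>" "x \<in> N" "y \<in> N"
      using tot by blast
    then show "x \<oplus>\<^bsub>M\<^esub> y \<in> \<Union>\<C>"
      using submoduleE(5)[OF sub] by blast
  qed (use assms(1) sub in \<open>auto dest: submoduleE submodule_zero\<close>)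
qed

lemma set_addI: "n \<in> N \<Longrightarrow> k \<in> K \<Longrightarrow> n \<oplus>\<^bsub>M\<^esub> k \<in> N <+>\<^bsub>M\<^esub> K"
  by (auto simp: set_add_def')

lemma set_addE:
  assumes "x \<in> N <+>\<^bsub>M\<^esub> K"
  obtains n k where "n \<in> N" "k \<in> K" "x = n \<oplus>\<^bsub>M\<^esub> k"
  using assms by (auto simp: set_add_def')

lemma submodule_set_add:
  assumes N: "submodule N R M" and K: "submodule K R M"
  shows "submodule (N <+>\<^bsub>M\<^esub> K) R M"
proof (rule submoduleI)
  note NE = submoduleE[OF N] submodule_zero[OF N]
  note KE = submoduleE[OF K] submodule_zero[OF K]
  show "N <+>\<^bsub>M\<^esub> K \<subseteq> carrier M"
    using NE KE by (auto simp: set_add_def')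
  show "\<zero>\<^bsub>M\<^esub> \<in> N <+>\<^bsub>M\<^esub> K"
    using NE KE by (auto simp: set_add_def' intro!: bexI[of _ "\<zero>\<^bsub>M\<^esub>"])
next
  fix x assume "x \<in> N <+>\<^bsub>M\<^esub> K"
  then obtain n k where x: "n \<in> N" "k \<in> K" "x = n \<oplus>\<^bsub>M\<^esub> k"
    by (auto simp: set_add_def')
  then have c: "n \<in> carrier M" "k \<in> carrier M"
    using submoduleE(1)[OF N] submoduleE(1)[OF K] by auto
  have "\<ominus>\<^bsub>M\<^esub> x = \<ominus>\<^bsub>M\<^esub> n \<oplus>\<^bsub>M\<^esub> \<ominus>\<^bsub>M\<^esub> k"
    using x c by (simp add: M.minus_add)
  then show "\<ominus>\<^bsub>M\<^esub> x \<in> N <+>\<^bsub>M\<^esub> K"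
    using x submoduleE(3)[OF N] submoduleE(3)[OF K] by (simp add: set_addI)
  fix a assume a: "a \<in> carrier R"
  have "a \<odot>\<^bsub>M\<^esub> x = a \<odot>\<^bsub>M\<^esub> n \<oplus>\<^bsub>M\<^esub> a \<odot>\<^bsub>M\<^esub> k"
    using x c a by (simp add: smult_r_distr)
  then show "a \<odot>\<^bsub>M\<^esub> x \<in> N <+>\<^bsub>M\<^esub> K"
    using x a submoduleE(4)[OF N] submoduleE(4)[OF K] by (simp add: set_addI)
next
  fix x y assume "x \<in> N <+>\<^bsub>M\<^esub> K" "y \<in> N <+>\<^bsub>M\<^esub> K"
  then obtain n k n' k' where x: "n \<in> N" "k \<in> K" "x = n \<oplus>\<^bsub>M\<^esub> k"
    and y: "n' \<in> N" "k' \<in> K" "y = n' \<oplus>\<^bsub>M\<^esub> k'"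
    by (auto simp: set_add_def')
  then have "n \<in> carrier M" "k \<in> carrier M" "n' \<in> carrier M" "k' \<in> carrier M"
    using submoduleE(1)[OF N] submoduleE(1)[OF K] by auto
  then have "x \<oplus>\<^bsub>M\<^esub> y = (n \<oplus>\<^bsub>M\<^esub> n') \<oplus>\<^bsub>M\<^esub> (k \<oplus>\<^bsub>M\<^esub> k')"
    using x y by (simp add: M.a_ac)
  then show "x \<oplus>\<^bsub>M\<^esub> y \<in> N <+>\<^bsub>M\<^esub> K"
    using x y submoduleE(5)[OF N] submoduleE(5)[OF K] by (simp add: set_addI)
qed

lemma set_add_upper:
  assumes N: "submodule N R M" and K: "submodule K R M"
  shows "N \<subseteq> N <+>\<^bsub>M\<^esub> K" and "K \<subseteq> N <+>\<^bsub>M\<^esub> K"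
proof
  fix x assume "x \<in> N"
  then have "x = x \<oplus>\<^bsub>M\<^esub> \<zero>\<^bsub>M\<^esub>"
    using submoduleE(1)[OF N] by auto
  then show "x \<in> N <+>\<^bsub>M\<^esub> K"
    using set_addI[OF \<open>x \<in> N\<close> submodule_zero[OF K]] by metis
next
  show "K \<subseteq> N <+>\<^bsub>M\<^esub> K"
  proof
    fix x assume "x \<in> K"
    then have "x = \<zero>\<^bsub>M\<^esub> \<oplus>\<^bsub>M\<^esub> x"
      using submoduleE(1)[OF K] by auto
    then show "x \<in> N <+>\<^bsub>M\<^esub> K"
      using set_addI[OF submodule_zero[OF N] \<open>x \<in> K\<close>] by metis
  qed
qed

lemma submodule_colon:
  assumes N: "submodule N R M" and a: "a \<in> carrier R"
  shows "submodule {x \<in> carrier M. a \<odot>\<^bsub>M\<^esub> x \<in> N} R M"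
proof (rule submoduleI)
  note NE = submoduleE[OF N] submodule_zero[OF N]
  fix b x assume b: "b \<in> carrier R" and x: "x \<in> {x \<in> carrier M. a \<odot>\<^bsub>M\<^esub> x \<in> N}"
  then have "a \<odot>\<^bsub>M\<^esub> (b \<odot>\<^bsub>M\<^esub> x) = b \<odot>\<^bsub>M\<^esub> (a \<odot>\<^bsub>M\<^esub> x)"
    using a by (simp flip: smult_assoc1 add: R.m_comm)
  then show "b \<odot>\<^bsub>M\<^esub> x \<in> {x \<in> carrier M. a \<odot>\<^bsub>M\<^esub> x \<in> N}"
    using b x NE by auto
qed (use submoduleE[OF N] submodule_zero[OF N] a in \<open>auto simp: smult_r_minus smult_r_distr\<close>)

lemma submodule_smult_image:
  assumes N: "submodule N R M" and a: "a \<in> carrier R"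
  shows "submodule ((\<lambda>x. a \<odot>\<^bsub>M\<^esub> x) ` N) R M"
proof (rule submoduleI)
  note NE = submoduleE[OF N] submodule_zero[OF N]
  show "(\<lambda>x. a \<odot>\<^bsub>M\<^esub> x) ` N \<subseteq> carrier M"
    using NE a by auto
  show "\<zero>\<^bsub>M\<^esub> \<in> (\<lambda>x. a \<odot>\<^bsub>M\<^esub> x) ` N"
    using NE a by (auto intro!: image_eqI[of _ _ "\<zero>\<^bsub>M\<^esub>"])
next
  note NE = submoduleE[OF N]
  fix x assume "x \<in> (\<lambda>x. a \<odot>\<^bsub>M\<^esub> x) ` N"
  then obtain n where n: "n \<in> N" "x = a \<odot>\<^bsub>M\<^esub> n" "n \<in> carrier M"
    using NE(1) by auto
  then show "\<ominus>\<^bsub>M\<^esub> x \<in> (\<lambda>x. a \<odot>\<^bsub>M\<^esub> x) ` N"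
    using NE(3) a by (auto simp flip: smult_r_minus)
  fix b assume b: "b \<in> carrier R"
  have "b \<odot>\<^bsub>M\<^esub> x = a \<odot>\<^bsub>M\<^esub> (b \<odot>\<^bsub>M\<^esub> n)"
    using n a b by (simp flip: smult_assoc1 add: R.m_comm)
  then show "b \<odot>\<^bsub>M\<^esub> x \<in> (\<lambda>x. a \<odot>\<^bsub>M\<^esub> x) ` N"
    using NE(4) b n by auto
next
  note NE = submoduleE[OF N]
  fix x y assume "x \<in> (\<lambda>x. a \<odot>\<^bsub>M\<^esub> x) ` N" "y \<in> (\<lambda>x. a \<odot>\<^bsub>M\<^esub> x) ` N"
  then obtain n n' where "n \<in> N" "x = a \<odot>\<^bsub>M\<^esub> n" "n \<in> carrier M"
    "n' \<in> N" "y = a \<odot>\<^bsub>M\<^esub> n'" "n' \<in> carrier M"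
    using NE(1) by auto
  then show "x \<oplus>\<^bsub>M\<^esub> y \<in> (\<lambda>x. a \<odot>\<^bsub>M\<^esub> x) ` N"
    using NE(5) a by (auto simp flip: smult_r_distr)
qed

lemma submodule_cyclic:
  assumes x: "x \<in> carrier M"
  shows "submodule ((\<lambda>a. a \<odot>\<^bsub>M\<^esub> x) ` carrier R) R M"
proof (rule submoduleI)
  let ?C = "(\<lambda>a. a \<odot>\<^bsub>M\<^esub> x) ` carrier R"
  show "?C \<subseteq> carrier M"
    using x by auto
  show "\<zero>\<^bsub>M\<^esub> \<in> ?C"
    using x by (auto intro!: image_eqI[of _ _ \<zero>])
  fix y assume "y \<in> ?C"
  then obtain a where a: "a \<in> carrier R" "y = a \<odot>\<^bsub>M\<^esub> x" by blast
  show "\<ominus>\<^bsub>M\<^esub> y \<in> ?C"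
    using a x by (auto simp: smult_l_minus intro!: image_eqI[of _ _ "\<ominus> a"])
  show "b \<odot>\<^bsub>M\<^esub> y \<in> ?C" if "b \<in> carrier R" for b
    using a x that by (auto simp: smult_assoc1 intro!: image_eqI[of _ _ "b \<otimes> a"])
  fix z assume "z \<in> ?C"
  then obtain b where "b \<in> carrier R" "z = b \<odot>\<^bsub>M\<^esub> x" by blast
  then show "y \<oplus>\<^bsub>M\<^esub> z \<in> ?C"
    using a x by (auto simp: smult_l_distr intro!: image_eqI[of _ _ "a \<oplus> b"])
qed

lemma submodule_submodule_span:
  assumes "A \<subseteq> carrier M"
  shows "submodule (submodule_span R M A) R M"
  unfolding submodule_span_def hull_def
  using assms carrier_is_submodule by (intro submodule_Inter) auto

lemma submodule_span_superset: "A \<subseteq> submodule_span R M A"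
  unfolding submodule_span_def by (rule hull_subset)

lemma submodule_span_minimal:
  "A \<subseteq> N \<Longrightarrow> submodule N R M \<Longrightarrow> submodule_span R M A \<subseteq> N"
  unfolding submodule_span_def by (rule hull_minimal)

section \<open>Finiteness up to a multiplier\<close>

lemma s_finite_span_iff:
  assumes N: "submodule N R M"
  shows "s_finite R M s N \<longleftrightarrow>
    (\<exists>A. finite A \<and> A \<subseteq> N \<and> (\<forall>x\<in>N. s \<odot>\<^bsub>M\<^esub> x \<in> submodule_span R M A))"
proof
  assume "s_finite R M s N"
  then obtain A where "finite A" "(\<lambda>x. s \<odot>\<^bsub>M\<^esub> x) ` N \<subseteq> submodule_span R M A"
      "submodule_span R M A \<subseteq> N"
    unfolding s_finite_def fg_submodule_def by metis
  then show "\<exists>A. finite A \<and> A \<subseteq> N \<and> (\<forall>x\<in>N. s \<odot>\<^bsub>M\<^esub> x \<in> submodule_span R M A)"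
    using subset_trans[OF submodule_span_superset] by (intro exI[of _ A]) auto
next
  assume "\<exists>A. finite A \<and> A \<subseteq> N \<and> (\<forall>x\<in>N. s \<odot>\<^bsub>M\<^esub> x \<in> submodule_span R M A)"
  then obtain A where A: "finite A" "A \<subseteq> N" "\<And>x. x \<in> N \<Longrightarrow> s \<odot>\<^bsub>M\<^esub> x \<in> submodule_span R M A"
    by metis
  have "fg_submodule R M (submodule_span R M A)"
    unfolding fg_submodule_def using A(1,2) submoduleE(1)[OF N] by (intro exI[of _ A]) auto
  then show "s_finite R M s N"
    unfolding s_finite_def using A(3) submodule_span_minimal[OF A(2) N]
    by (intro exI[of _ "submodule_span R M A"]) auto
qed

lemma s_finiteE:
  assumes "s_finite R M s N" "submodule N R M"
  obtains A where "finite A" "A \<subseteq> N" "\<forall>x\<in>N. s \<odot>\<^bsub>M\<^esub> x \<in> submodule_span R M A"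
  using iffD1[OF s_finite_span_iff[OF assms(2)] assms(1)] by metis

lemma s_finite_mult:
  assumes N: "submodule N R M" and fin: "s_finite R M s N"
    and r: "r \<in> carrier R" and s: "s \<in> carrier R"
  shows "s_finite R M (r \<otimes> s) N"
proof -
  obtain A where A: "finite A" "A \<subseteq> N" "\<forall>x\<in>N. s \<odot>\<^bsub>M\<^esub> x \<in> submodule_span R M A"
    by (rule s_finiteE[OF fin N])
  have "submodule (submodule_span R M A) R M"
    using A(2) submoduleE(1)[OF N] by (intro submodule_submodule_span) auto
  then have "\<forall>x\<in>N. (r \<otimes> s) \<odot>\<^bsub>M\<^esub> x \<in> submodule_span R M A"
    using A(3) r s submoduleE(1)[OF N] by (auto simp: smult_assoc1 subset_iff submoduleE(4))
  then show ?thesis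
    using A(1,2) iffD2[OF s_finite_span_iff[OF N]] by blast
qed

lemma s_finite_smult_image:
  assumes N: "submodule N R M" and fin: "s_finite R M s N"
    and a: "a \<in> carrier R" and s: "s \<in> carrier R"
  shows "s_finite R M s ((\<lambda>x. a \<odot>\<^bsub>M\<^esub> x) ` N)"
proof -
  let ?f = "\<lambda>x. a \<odot>\<^bsub>M\<^esub> x"
  obtain A where A: "finite A" "A \<subseteq> N" "\<forall>x\<in>N. s \<odot>\<^bsub>M\<^esub> x \<in> submodule_span R M A"
    by (rule s_finiteE[OF fin N])
  have AM: "A \<subseteq> carrier M"
    using A(2) submoduleE(1)[OF N] by blast
  let ?L = "submodule_span R M (?f ` A)"
  have L: "submodule ?L R M"
    using AM a by (intro submodule_submodule_span) auto
  have "submodule_span R M A \<subseteq> {x \<in> carrier M. ?f x \<in> ?L}"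
    using AM submodule_span_superset[of "?f ` A"]
    by (intro submodule_span_minimal submodule_colon[OF L a]) auto
  moreover have "s \<odot>\<^bsub>M\<^esub> ?f x = ?f (s \<odot>\<^bsub>M\<^esub> x)" if "x \<in> N" for x
    using that a s submoduleE(1)[OF N] by (auto simp flip: smult_assoc1 simp: R.m_comm)
  ultimately have "\<forall>y\<in>?f ` N. s \<odot>\<^bsub>M\<^esub> y \<in> ?L"
    using A(3) by fastforce
  moreover have "finite (?f ` A)" "?f ` A \<subseteq> ?f ` N"
    using A(1,2) by auto
  ultimately show ?thesis
    using s_finite_span_iff[OF submodule_smult_image[OF N a]] by metis
qed

text \<open>
  The analogue of the fact that an extension of a finitely generated module by a finitely generated
  module is finitely generated. Split each generator used for \<open>N + H\<close> as \<open>n + h\<close>. For \<open>x \<in> N\<close> the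
  multiple \<open>ux\<close> is a combination of the \<open>n\<close>-parts plus an element of \<open>H\<close>; the latter is a difference
  of elements of \<open>N\<close>, so it lies in \<open>N \<inter> H\<close>, and multiplying by \<open>v\<close> brings it into the span of the
  generators used for \<open>K\<close>. Allowing any \<open>K\<close> between \<open>N \<inter> H\<close> and \<open>N\<close>, and not just \<open>K = N \<inter> H\<close>, matters
  because submodules of \<open>s\<close>-finite modules need not be \<open>s\<close>-finite.
\<close>
lemma s_finite_extension:
  assumes N: "submodule N R M" and H: "submodule H R M" and K: "submodule K R M"
    and NH: "N \<inter> H \<subseteq> K" and KN: "K \<subseteq> N"
    and finNH: "s_finite R M u (N <+>\<^bsub>M\<^esub> H)" and finK: "s_finite R M v K"
    and u: "u \<in> carrier R" and v: "v \<in> carrier R"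
  shows "s_finite R M (v \<otimes> u) N"
proof -
  have NM: "N \<subseteq> carrier M" and HM: "H \<subseteq> carrier M"
    using submoduleE(1)[OF N] submoduleE(1)[OF H] by auto
  obtain A where A: "finite A" "A \<subseteq> N <+>\<^bsub>M\<^esub> H"
    "\<forall>x \<in> N <+>\<^bsub>M\<^esub> H. u \<odot>\<^bsub>M\<^esub> x \<in> submodule_span R M A"
    by (rule s_finiteE[OF finNH submodule_set_add[OF N H]])
  obtain B where B: "finite B" "B \<subseteq> K" "\<forall>x\<in>K. v \<odot>\<^bsub>M\<^esub> x \<in> submodule_span R M B"
    by (rule s_finiteE[OF finK K])
  have "\<forall>e\<in>A. \<exists>n h. n \<in> N \<and> h \<in> H \<and> e = n \<oplus>\<^bsub>M\<^esub> h"
  proof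
    fix e assume "e \<in> A"
    then have "e \<in> N <+>\<^bsub>M\<^esub> H"
      using A(2) by (rule rev_subsetD)
    then show "\<exists>n h. n \<in> N \<and> h \<in> H \<and> e = n \<oplus>\<^bsub>M\<^esub> h"
      by (rule set_addE) (intro exI conjI)
  qed
  then obtain n h where nh: "\<And>e. e \<in> A \<Longrightarrow> n e \<in> N \<and> h e \<in> H \<and> e = n e \<oplus>\<^bsub>M\<^esub> h e"
    by metis
  let ?A = "submodule_span R M (n ` A)" and ?G = "submodule_span R M (n ` A \<union> B)"
  have A': "submodule ?A R M" and G: "submodule ?G R M"
    using nh NM B(2) KN by (auto intro!: submodule_submodule_span)
  have AN: "?A \<subseteq> N"
    using nh by (intro submodule_span_minimal[OF _ N]) auto
  have AG: "?A \<subseteq> ?G" and BG: "submodule_span R M B \<subseteq> ?G"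
    unfolding submodule_span_def by (auto intro!: hull_mono)
  have "A \<subseteq> ?A <+>\<^bsub>M\<^esub> H"
  proof
    fix e assume e: "e \<in> A"
    then have "n e \<in> ?A"
      using submodule_span_superset[of "n ` A"] by auto
    then have "n e \<oplus>\<^bsub>M\<^esub> h e \<in> ?A <+>\<^bsub>M\<^esub> H"
      using nh[OF e] by (intro set_addI) auto
    then show "e \<in> ?A <+>\<^bsub>M\<^esub> H"
      using nh[OF e] by simp
  qed
  then have spanA: "submodule_span R M A \<subseteq> ?A <+>\<^bsub>M\<^esub> H"
    by (rule submodule_span_minimal[OF _ submodule_set_add[OF A' H]])
  have "(v \<otimes> u) \<odot>\<^bsub>M\<^esub> x \<in> ?G" if x: "x \<in> N" for x
  proof -
    have "u \<odot>\<^bsub>M\<^esub> x \<in> ?A <+>\<^bsub>M\<^esub> H"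
      using A(3) x set_add_upper(1)[OF N H] spanA by blast
    then obtain y z where yz: "y \<in> ?A" "z \<in> H" "u \<odot>\<^bsub>M\<^esub> x = y \<oplus>\<^bsub>M\<^esub> z"
      by (rule set_addE)
    have c: "y \<in> carrier M" "z \<in> carrier M" "x \<in> carrier M"
      using yz AN NM HM x by auto
    have "z = u \<odot>\<^bsub>M\<^esub> x \<ominus>\<^bsub>M\<^esub> y"
      using yz(3) c by (simp add: a_minus_def M.a_comm[of y z] M.a_assoc M.r_neg)
    then have "z \<in> N"
      using submodule_minus[OF N] submoduleE(4)[OF N u x] yz(1) AN by auto
    then have "v \<odot>\<^bsub>M\<^esub> z \<in> ?G"
      using yz(2) NH B(3) BG by blast
    moreover have "v \<odot>\<^bsub>M\<^esub> y \<in> ?G"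
      using yz(1) AG submoduleE(4)[OF G v] by blast
    moreover have "(v \<otimes> u) \<odot>\<^bsub>M\<^esub> x = v \<odot>\<^bsub>M\<^esub> y \<oplus>\<^bsub>M\<^esub> v \<odot>\<^bsub>M\<^esub> z"
      using c u v yz(3) by (simp add: smult_assoc1 smult_r_distr)
    ultimately show ?thesis
      using submoduleE(5)[OF G] by simp
  qed
  moreover have "finite (n ` A \<union> B)" "n ` A \<union> B \<subseteq> N"
    using A(1) B(1,2) nh KN by auto
  ultimately show ?thesis
    using iffD2[OF s_finite_span_iff[OF N]] by blast
qed

lemma S_finite_extension:
  assumes "submonoid T R"
    and "submodule N R M" "submodule H R M" "submodule K R M" "N \<inter> H \<subseteq> K" "K \<subseteq> N"
    and "S_finite R M T (N <+>\<^bsub>M\<^esub> H)" "S_finite R M T K"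
  shows "S_finite R M T N"
proof -
  interpret T: submonoid T R by fact
  obtain u v where uv: "u \<in> T" "v \<in> T" "s_finite R M u (N <+>\<^bsub>M\<^esub> H)" "s_finite R M v K"
    using assms(7,8) unfolding S_finite_def by blast
  then have "s_finite R M (v \<otimes> u) N"
    using assms(2-6) T.subset by (blast intro: s_finite_extension)
  then show ?thesis
    using uv unfolding S_finite_def by blast
qed

section \<open>Maximal submodules that are not finite are prime\<close>

text \<open>
  The finitely many generators witnessing that the union of a chain is \<open>T\<close>-finite already lie in one
  member of the chain, and they witness that this member is \<open>T\<close>-finite; so the submodules that
  are not \<open>T\<close>-finite are closed under unions of chains.
\<close>
lemma maximal_non_S_finite_exists:
  assumes "submodule L R M" "\<not> S_finite R M T L"
  obtains N where "submodule N R M" "\<not> S_finite R M T N"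
    "\<And>K. submodule K R M \<Longrightarrow> N \<subset> K \<Longrightarrow> S_finite R M T K"
proof -
  define \<A> where "\<A> = {N. submodule N R M \<and> \<not> S_finite R M T N}"
  have "\<exists>N\<in>\<A>. \<forall>X\<in>\<A>. N \<subseteq> X \<longrightarrow> X = N"
  proof (rule subset_Zorn_nonempty)
    show "\<A> \<noteq> {}"
      using assms unfolding \<A>_def by blast
    fix \<C> assume ne: "\<C> \<noteq> {}" and chain: "subset.chain \<A> \<C>"
    have "subset.chain {N. submodule N R M} \<C>"
      using chain unfolding subset_chain_def \<A>_def by blast
    then have U: "submodule (\<Union>\<C>) R M"
      by (rule submodule_chain_Union[OF ne])
    have "\<not> S_finite R M T (\<Union>\<C>)"
    proof
      assume "S_finite R M T (\<Union>\<C>)"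
      then obtain t where t: "t \<in> T" "s_finite R M t (\<Union>\<C>)"
        unfolding S_finite_def by blast
      obtain A where A: "finite A" "A \<subseteq> \<Union>\<C>"
        "\<forall>x\<in>\<Union>\<C>. t \<odot>\<^bsub>M\<^esub> x \<in> submodule_span R M A"
        by (rule s_finiteE[OF t(2) U])
      obtain N where N: "N \<in> \<C>" "A \<subseteq> N"
        using finite_subset_Union_chain[OF A(1,2) ne chain] by blast
      then have NA: "N \<in> \<A>"
        using chain unfolding subset_chain_def by blast
      then have NR: "submodule N R M"
        unfolding \<A>_def by blast
      have "\<forall>x\<in>N. t \<odot>\<^bsub>M\<^esub> x \<in> submodule_span R M A"
        using A(3) N(1) by blast
      then have "s_finite R M t N"
        using A(1) N(2) by (intro iffD2[OF s_finite_span_iff[OF NR]] exI[of _ A]) simp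
      then show False
        using t(1) NA unfolding \<A>_def S_finite_def by blast
    qed
    then show "\<Union>\<C> \<in> \<A>"
      using U unfolding \<A>_def by blast
  qed
  then show thesis
    using that unfolding \<A>_def by blast
qed

text \<open>
  If \<open>ax \<in> N\<close> with \<open>x \<notin> N\<close> and \<open>aM\<close> not inside \<open>N\<close>, then both \<open>(N : a)\<close> and \<open>N + aM\<close> are strictly larger
  than \<open>N\<close>, hence \<open>T\<close>-finite. Since \<open>N \<inter> aM = a(N : a)\<close>, the extension principle would make \<open>N\<close>
  \<open>T\<close>-finite too.
\<close>
lemma maximal_non_S_finite_prime:
  assumes T: "submonoid T R" and N: "submodule N R M" and notfin: "\<not> S_finite R M T N"
    and max: "\<And>K. submodule K R M \<Longrightarrow> N \<subset> K \<Longrightarrow> S_finite R M T K"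
    and a: "a \<in> carrier R" and x: "x \<in> carrier M" and ax: "a \<odot>\<^bsub>M\<^esub> x \<in> N" and xN: "x \<notin> N"
    and y: "y \<in> carrier M"
  shows "a \<odot>\<^bsub>M\<^esub> y \<in> N"
proof (rule ccontr)
  assume ay: "a \<odot>\<^bsub>M\<^esub> y \<notin> N"
  let ?f = "\<lambda>x. a \<odot>\<^bsub>M\<^esub> x"
  define C where "C = {x \<in> carrier M. ?f x \<in> N}"
  define H where "H = ?f ` carrier M"
  have C: "submodule C R M"
    unfolding C_def by (rule submodule_colon[OF N a])
  have H: "submodule H R M"
    unfolding H_def by (rule submodule_smult_image[OF carrier_is_submodule a])
  have "N \<subseteq> C"
    unfolding C_def using submoduleE(1)[OF N] submoduleE(4)[OF N a] by auto
  moreover have "x \<in> C"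
    unfolding C_def using x ax by simp
  ultimately have "N \<subset> C"
    using xN by auto
  then have "S_finite R M T C"
    by (rule max[OF C])
  then have finC: "S_finite R M T (?f ` C)"
    unfolding S_finite_def using s_finite_smult_image[OF C _ a] submonoid.subset[OF T] by blast
  have "a \<odot>\<^bsub>M\<^esub> y \<in> H"
    unfolding H_def using y by (rule imageI)
  then have "N \<subset> N <+>\<^bsub>M\<^esub> H"
    using set_add_upper[OF N H] ay by auto
  then have finH: "S_finite R M T (N <+>\<^bsub>M\<^esub> H)"
    by (rule max[OF submodule_set_add[OF N H]])
  have "N \<inter> H \<subseteq> ?f ` C" "?f ` C \<subseteq> N"
    unfolding H_def C_def by auto
  then show False
    using S_finite_extension[OF T N H submodule_smult_image[OF C a] _ _ finH finC] notfin
    by blast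
qed

section \<open>Finiteness at the primes suffices\<close>

lemma ideal_smult_incl:
  assumes "submodule N R M" "\<And>a x. a \<in> I \<Longrightarrow> x \<in> carrier M \<Longrightarrow> a \<odot>\<^bsub>M\<^esub> x \<in> N"
  shows "ideal_smult R M I \<subseteq> N"
  unfolding ideal_smult_def using assms by (intro submodule_span_minimal) auto

lemma smult_in_ideal_smult:
  "a \<in> I \<Longrightarrow> x \<in> carrier M \<Longrightarrow> a \<odot>\<^bsub>M\<^esub> x \<in> ideal_smult R M I"
  unfolding ideal_smult_def by (rule set_mp[OF submodule_span_superset]) blast

lemma submodule_ideal_smult:
  assumes "I \<subseteq> carrier R"
  shows "submodule (ideal_smult R M I) R M"
  unfolding ideal_smult_def using assms by (intro submodule_submodule_span) auto

lemma ideal_smult_subset_prime_saturation: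
  assumes "primeideal P R"
  shows "ideal_smult R M P \<subseteq> prime_saturation R M P"
proof -
  interpret P: primeideal P R by fact
  have sub: "submodule (ideal_smult R M P) R M"
    using P.Icarr by (intro submodule_ideal_smult) auto
  have one: "\<one> \<in> carrier R - P"
    using P.I_notcarr P.one_imp_carrier by blast
  show ?thesis
  proof
    fix x assume x: "x \<in> ideal_smult R M P"
    then have "x \<in> carrier M"
      using submoduleE(1)[OF sub] by (rule rev_subsetD)
    then show "x \<in> prime_saturation R M P"
      using x one unfolding prime_saturation_def by (auto intro!: bexI[of _ \<one>])
  qed
qed

text \<open>
  The last hypothesis says that \<open>N\<close> is a prime submodule, that is, \<open>M/N\<close> is torsion-free over
  \<open>R/(N : M)\<close>. If \<open>abM \<subseteq> N\<close> but \<open>by \<notin> N\<close> for some \<open>y\<close>, then \<open>a\<close> sends an element outside \<open>N\<close> into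
  \<open>N\<close>, so \<open>aM \<subseteq> N\<close>.
\<close>
lemma primeideal_colon:
  assumes N: "submodule N R M" and proper: "N \<noteq> carrier M"
    and prime: "\<And>a x y. \<lbrakk>a \<in> carrier R; x \<in> carrier M; a \<odot>\<^bsub>M\<^esub> x \<in> N; x \<notin> N; y \<in> carrier M\<rbrakk>
      \<Longrightarrow> a \<odot>\<^bsub>M\<^esub> y \<in> N"
  shows "primeideal {a \<in> carrier R. \<forall>y\<in>carrier M. a \<odot>\<^bsub>M\<^esub> y \<in> N} R" (is "primeideal ?P R")
proof (rule primeidealI)
  note NE = submoduleE[OF N] submodule_zero[OF N]
  show "cring R" by (rule R.is_cring)
  show "ideal ?P R"
  proof (rule idealI[OF R.ring_axioms])
    show "subgroup ?P (add_monoid R)"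
      using NE by (intro R.add.subgroupI)
        (auto simp: smult_l_distr smult_l_minus simp flip: a_inv_def)
    show "x \<otimes> a \<in> ?P" "a \<otimes> x \<in> ?P" if "a \<in> ?P" "x \<in> carrier R" for a x
      using that NE by (auto simp: smult_assoc1)
  qed
  show "carrier R \<noteq> ?P"
  proof
    assume "carrier R = ?P"
    then have "\<one> \<in> ?P" using R.one_closed by blast
    then show False
      using proper NE(1) by auto
  qed
  fix a b assume a: "a \<in> carrier R" and b: "b \<in> carrier R" and ab: "a \<otimes> b \<in> ?P"
  show "a \<in> ?P \<or> b \<in> ?P"
  proof (rule ccontr)
    assume neg: "\<not> (a \<in> ?P \<or> b \<in> ?P)"
    then obtain y where y: "y \<in> carrier M" "b \<odot>\<^bsub>M\<^esub> y \<notin> N"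
      using b by blast
    then have "a \<odot>\<^bsub>M\<^esub> (b \<odot>\<^bsub>M\<^esub> y) \<in> N"
      using ab a b by (auto simp: smult_assoc1)
    then show False
      using prime[OF a, of "b \<odot>\<^bsub>M\<^esub> y"] y a b neg by blast
  qed
qed

text \<open>
  A Cohen-type theorem for \<open>T\<close>-finiteness with witnesses that may vary with the submodule. A maximal
  counterexample \<open>N\<close> is a prime submodule, so its colon ideal \<open>P = (N : M)\<close> is one of the primes of
  the hypothesis, and both \<open>N \<inter> Rx = Px\<close> for \<open>x \<notin> N\<close> and \<open>M(P) \<subseteq> N\<close> come from primeness.
\<close>
theorem S_finite_if_S_finite_at_primes:
  assumes T: "submonoid T R" and finM: "S_finite R M T (carrier M)"
    and primes: "\<And>P. \<lbrakk>primeideal P R; annihilator R M \<subseteq> P\<rbrakk> \<Longrightarrow>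
      \<exists>L. submodule L R M \<and> S_finite R M T L \<and>
        ideal_smult R M P \<subseteq> L \<and> L \<subseteq> prime_saturation R M P"
    and L: "submodule L R M"
  shows "S_finite R M T L"
proof (rule ccontr)
  assume "\<not> S_finite R M T L"
  with L obtain N where N: "submodule N R M" and notfin: "\<not> S_finite R M T N"
    and max: "\<And>K. submodule K R M \<Longrightarrow> N \<subset> K \<Longrightarrow> S_finite R M T K"
    by (rule maximal_non_S_finite_exists) blast
  note prime = maximal_non_S_finite_prime[OF T N notfin max]
  define P where "P = {a \<in> carrier R. \<forall>y\<in>carrier M. a \<odot>\<^bsub>M\<^esub> y \<in> N}"
  have proper: "N \<noteq> carrier M"
    using finM notfin by auto
  have "primeideal P R"
    unfolding P_def by (rule primeideal_colon[OF N proper]) (rule prime)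
  moreover have "annihilator R M \<subseteq> P"
    unfolding annihilator_def P_def using submodule_zero[OF N] by auto
  ultimately obtain K where K: "submodule K R M" "S_finite R M T K"
      "ideal_smult R M P \<subseteq> K" "K \<subseteq> prime_saturation R M P"
    using primes by blast
  have PN: "ideal_smult R M P \<subseteq> N"
    by (rule ideal_smult_incl[OF N]) (simp add: P_def)
  have "prime_saturation R M P \<subseteq> N"
  proof
    fix x assume "x \<in> prime_saturation R M P"
    then obtain r where r: "x \<in> carrier M" "r \<in> carrier R" "r \<notin> P" "r \<odot>\<^bsub>M\<^esub> x \<in> N"
      unfolding prime_saturation_def using PN by blast
    then show "x \<in> N"
      using prime[of r x] unfolding P_def by blast
  qed
  then have KN: "K \<subseteq> N"
    using K(4) by blast
  \<comment> \<open>Any element outside \<open>N\<close> works: primeness makes its annihilator modulo \<open>N\<close> equal to \<open>P\<close>.\<close>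
  obtain x where x: "x \<in> carrier M" "x \<notin> N"
    using proper submoduleE(1)[OF N] by blast
  define H where "H = (\<lambda>a. a \<odot>\<^bsub>M\<^esub> x) ` carrier R"
  have H: "submodule H R M"
    unfolding H_def by (rule submodule_cyclic[OF x(1)])
  have "\<one> \<odot>\<^bsub>M\<^esub> x \<in> H"
    unfolding H_def by blast
  then have "N \<subset> N <+>\<^bsub>M\<^esub> H"
    using set_add_upper[OF N H] x by auto
  then have finH: "S_finite R M T (N <+>\<^bsub>M\<^esub> H)"
    by (rule max[OF submodule_set_add[OF N H]])
  have "N \<inter> H \<subseteq> K"
  proof
    fix z assume z: "z \<in> N \<inter> H"
    then obtain a where a: "a \<in> carrier R" "z = a \<odot>\<^bsub>M\<^esub> x"
      unfolding H_def by blast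
    then have "a \<in> P"
      unfolding P_def using prime[of a x] x z by blast
    then show "z \<in> K"
      using smult_in_ideal_smult[of a P x] x(1) a(2) K(3) by blast
  qed
  then show False
    using S_finite_extension[OF T N H K(1) _ KN finH K(2)] notfin by blast
qed

end

section \<open>From varying witnesses to a uniform one\<close>

lemma (in monoid) submonoid_range_pow:
  assumes "s \<in> carrier G"
  shows "submonoid (range (\<lambda>n::nat. s [^] n)) G"
proof
  show "x \<otimes> y \<in> range (\<lambda>n::nat. s [^] n)"
    if xy: "x \<in> range (\<lambda>n::nat. s [^] n)" "y \<in> range (\<lambda>n::nat. s [^] n)" for x y
  proof -
    obtain m n :: nat where "x = s [^] m" "y = s [^] n"
      using xy by blast
    then show ?thesis
      using assms by (simp add: nat_pow_mult)
  qed
  show "\<one> \<in> range (\<lambda>n::nat. s [^] n)"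
    by (rule range_eqI[of _ _ 0]) simp
qed (use assms in auto)

lemma (in cring) anti_archimedeanE:
  assumes "anti_archimedean R S" "S \<subseteq> carrier R" "s \<in> S"
  obtains t where "t \<in> S" "\<And>n::nat. \<exists>r\<in>carrier R. t = r \<otimes> s [^] n"
proof -
  obtain t where t: "t \<in> S" "\<And>n::nat. n \<ge> 1 \<Longrightarrow> t \<in> PIdl (s [^] n)"
    using assms(1,3) unfolding anti_archimedean_def by fastforce
  have "\<exists>r\<in>carrier R. t = r \<otimes> s [^] n" for n :: nat
  proof (cases "n = 0")
    \<comment> \<open>The intersection of the principal ideals starts at \<open>n = 1\<close>.\<close>
    case True
    then show ?thesis
      using t(1) assms(2) by (intro bexI[of _ t]) auto
  next
    case False
    then show ?thesis
      using t(2)[of n] unfolding cgenideal_def by auto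
  qed
  then show thesis
    using that t(1) by blast
qed

theorem theorem2p3:
  fixes R :: "('a, 'm) ring_scheme" and M :: "('a, 'b, 'n) module_scheme" and S :: "'a set"
  assumes "cring R"
    and "submonoid S R"
    and "anti_archimedean R S"
    and "module R M"
  shows "uniformly_S_Noetherian R S M \<longleftrightarrow>
    (\<exists>s\<in>S. s_finite R M s (carrier M) \<and>
      (\<forall>P. primeideal P R \<and> annihilator R M \<subseteq> P \<longrightarrow>
        (\<exists>N. submodule N R M \<and> s_finite R M s N \<and>
          ideal_smult R M P \<subseteq> N \<and> N \<subseteq> prime_saturation R M P)))"
    (is "_ \<longleftrightarrow> (\<exists>s\<in>S. ?cond s)")
proof
  interpret module R M by fact
  assume "uniformly_S_Noetherian R S M"
  then obtain s where s: "s \<in> S" "\<And>N. submodule N R M \<Longrightarrow> s_finite R M s N"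
    unfolding uniformly_S_Noetherian_def by blast
  have "\<exists>N. submodule N R M \<and> s_finite R M s N \<and>
      ideal_smult R M P \<subseteq> N \<and> N \<subseteq> prime_saturation R M P" if P: "primeideal P R" for P
  proof -
    have "P \<subseteq> carrier R"
      using P additive_subgroup.a_subset ideal.axioms(1) primeideal.axioms(1) by blast
    then show ?thesis
      using s(2) submodule_ideal_smult ideal_smult_subset_prime_saturation[OF P] by blast
  qed
  then show "\<exists>s\<in>S. ?cond s"
    using s carrier_is_submodule by blast
next
  interpret module R M by fact
  interpret S: submonoid S R by fact
  assume "\<exists>s\<in>S. ?cond s"
  then obtain s where s: "s \<in> S" and cond: "?cond s" by blast
  have sR: "s \<in> carrier R"
    using s S.subset by blast
  let ?T = "range (\<lambda>n::nat. s [^]\<^bsub>R\<^esub> n)"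
  have T: "submonoid ?T R"
    by (rule R.submonoid_range_pow[OF sR])
  have "s \<in> ?T"
    using sR by (intro range_eqI[of _ _ 1]) simp
  then have up: "S_finite R M ?T N" if "s_finite R M s N" for N
    using that unfolding S_finite_def by blast
  obtain t where t: "t \<in> S" "\<And>n::nat. \<exists>r\<in>carrier R. t = r \<otimes>\<^bsub>R\<^esub> s [^]\<^bsub>R\<^esub> n"
    using R.anti_archimedeanE[OF assms(3) S.subset s] by blast
  have "s_finite R M t N" if N: "submodule N R M" for N
  proof -
    have "S_finite R M ?T N"
    proof (rule S_finite_if_S_finite_at_primes[OF T _ _ N])
      show "S_finite R M ?T (carrier M)"
        using cond up by blast
      show "\<exists>L. submodule L R M \<and> S_finite R M ?T L \<and>
          ideal_smult R M P \<subseteq> L \<and> L \<subseteq> prime_saturation R M P"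
        if "primeideal P R" "annihilator R M \<subseteq> P" for P
        using cond that up by meson
    qed
    then obtain n :: nat where n: "s_finite R M (s [^]\<^bsub>R\<^esub> n) N"
      unfolding S_finite_def by blast
    obtain r where "r \<in> carrier R" "t = r \<otimes>\<^bsub>R\<^esub> s [^]\<^bsub>R\<^esub> n"
      using t(2)[of n] by blast
    then show ?thesis
      using s_finite_mult[OF N n] sR by simp
  qed
  then show "uniformly_S_Noetherian R S M"
    using t(1) unfolding uniformly_S_Noetherian_def by blast
qed

end
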